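(* Let $1\le j\le k\le n$, let $e_1\ge e_2\ge\cdots\ge e_j\ge1$ be integers, and let $m=x_1^{1+e_1}\cdots x_j^{1+e_j}x_{j+1}\cdots x_k\in K[x_1,\dots,x_n]$. Set $$p:=1+\max_{1\le i\le j}\left\lfloor\frac{(n-i+1)e_i}{k-i+1}\right\rfloor .$$ Then for every $G(r,1,n)$-invariant ideal $I\subset K[x_1,\dots,x_n]$ containing $m$ one has $I_{((k),\,n-k)}^{\,p}\subset I$. Moreover $p$ is minimal: there exists a $G(r,1,n)$-invariant ideal $I$ containing $m$ with $I_{((k),\,n-k)}^{\,p-1}\not\subset I$.
   Context: Standing assumptions: $r\ge 2$, and $K$ is an infinite field containing all $r$-th roots of unity (e.g. algebraically closed). $\mu_r\subset K^\times$ is the group of $r$-th roots of unity, and $$G(r,1,n)=(\mathbb{Z}/r\mathbb{Z})\wr S_n=\{(\eta_1,\dots,\eta_n;\sigma):\eta_i\in\mu_r,\ \sigma\in S_n\}$$ acts on $K[x_1,\dots,x_n]$ by $(\eta;\sigma)\cdot f(x_1,\dots,x_n)=f(\eta_{\sigma(1)}x_{\sigma(1)},\dots,\eta_{\sigma(n)}x_{\sigma(n)})$. $I^{p}$ denotes the ordinary $p$-th power of an ideal $I$, and $(k)$ is the one-part partition of $k$; $I_{((k),n-k)}$ is the case $\mu=(k)$, $z=n-k$ of the following definition. Classical Specht ideal: for a partition $\mu\vdash N$, $I_\mu\subset K[y_1,\dots,y_N]$ is the ideal generated by the Specht polynomials of all tableaux $T$ of shape $\mu$ (bijective fillings with $1,\dots,N$);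 the Specht polynomial of $T$ is the product over the columns of $T$ of the Vandermonde products $\prod(y_a-y_b)$ over pairs of entries $a,b$ in that column (one factor for each pair; empty products equal $1$). Definition of $I_{(\mu,z)}$: let $0\le z\le n$ and $\mu\vdash n-z$. For $S=\{i_1<\dots<i_{n-z}\}\subset\{1,\dots,n\}$, let $\phi_S:K[y_1,\dots,y_{n-z}]\to K[x_{i_1},\dots,x_{i_{n-z}}]$ be the $K$-algebra homomorphism $y_j\mapsto x_{i_j}^r$, and let $X_S=(x_j:j\notin S)\subset K[x_1,\dots,x_n]$. Let $I_{\ge z+1}$ be the ideal of $K[x_1,\dots,x_n]$ generated by all squarefree monomials of degree $n-z$. Then $$I_{(\mu,z)}:=\Big[\bigcap_{S\subset\{1,\dots,n\},\,|S|=n-z}\big(X_S+\phi_S(I_\mu)\big)\Big]\cap I_{\ge z+1},$$ where $X_S+\phi_S(I_\mu)$ denotes the ideal of $K[x_1,\dots,x_n]$ generated by $X_S$ and $\phi_S(I_\mu)$. *)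

theory Defs
  imports
    "HOL-Library.Poly_Mapping"
    "HOL-Library.FuncSet"
    "HOL-Combinatorics.Permutations"
    "HOL-Computational_Algebra.Polynomial"
    "HOL-Algebra.Ideal_Product"
begin

section \<open>The polynomial ring $K[x_1,\dots,x_n]$\<close>

text \<open>
  Polynomials in the variables $x_0, x_1, x_2, \dots$ over \<open>'a\<close> are finitely supported functions
  from exponent vectors to coefficients. The ring $K[x_1,\dots,x_n]$ is the subring of polynomials
  involving only $x_1,\dots,x_n$; ideals of it are subsets of its carrier.
\<close>

type_synonym 'a mpoly = "(nat \<Rightarrow>\<^sub>0 nat) \<Rightarrow>\<^sub>0 'a"

definition Var :: "nat \<Rightarrow> 'a::field mpoly" where
  "Var i = Poly_Mapping.single (Poly_Mapping.single i 1) 1"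

definition Const :: "'a \<Rightarrow> 'a::field mpoly" where
  "Const c = Poly_Mapping.single 0 c"

definition mpoly_ring :: "nat \<Rightarrow> 'a::field mpoly ring" where
  "mpoly_ring n = \<lparr> carrier = {f. \<forall>m \<in> Poly_Mapping.keys f. Poly_Mapping.keys m \<subseteq> {1..n}},
                    mult = (*), one = 1, zero = 0, add = (+) \<rparr>"

text \<open>The \<open>K\<close>-algebra homomorphism determined by $x_i \mapsto g(i)$.\<close>

definition subst :: "(nat \<Rightarrow> 'a::field mpoly) \<Rightarrow> 'a mpoly \<Rightarrow> 'a mpoly" where
  "subst g f = (\<Sum>m \<in> Poly_Mapping.keys f.
     Const (Poly_Mapping.lookup f m) * (\<Prod>i \<in> Poly_Mapping.keys m. g i ^ Poly_Mapping.lookup m i))"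

definition ideal_power :: "nat \<Rightarrow> 'a::field mpoly set \<Rightarrow> nat \<Rightarrow> 'a mpoly set" where
  "ideal_power n I p = I [^]\<^bsub>ideals_set (mpoly_ring n)\<^esub> p"


section \<open>Roots of unity and the group $G(r,1,n)$\<close>

text \<open>
  \<open>K\<close> contains all \<open>r\<close>-th roots of unity (those of an algebraic closure) iff $X^r - 1$ splits over
  \<open>K\<close>. The characteristic is allowed to divide \<open>r\<close>, so this holds for every algebraically
  closed field.
\<close>

definition contains_roots_of_unity :: "'a::field itself \<Rightarrow> nat \<Rightarrow> bool" where
  "contains_roots_of_unity _ r \<longleftrightarrow>
     (\<exists>as :: 'a list. length as = r \<and>
        Polynomial.monom (1::'a) r - 1 = (\<Prod>a\<leftarrow>as. [:- a, 1:]))"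

definition roots_of_unity :: "nat \<Rightarrow> 'a::field set" where
  "roots_of_unity r = {\<eta>. \<eta> ^ r = 1}"

definition Gr1n :: "nat \<Rightarrow> nat \<Rightarrow> ((nat \<Rightarrow> 'a::field) \<times> (nat \<Rightarrow> nat)) set" where
  "Gr1n r n = ({1..n} \<rightarrow>\<^sub>E roots_of_unity r) \<times> {\<sigma>. \<sigma> permutes {1..n}}"

text \<open>$(\eta;\sigma)\cdot f = f(\eta_{\sigma(1)} x_{\sigma(1)}, \dots, \eta_{\sigma(n)} x_{\sigma(n)})$\<close>

definition Gr1n_act :: "(nat \<Rightarrow> 'a::field) \<times> (nat \<Rightarrow> nat) \<Rightarrow> 'a mpoly \<Rightarrow> 'a mpoly" where
  "Gr1n_act = (\<lambda>(\<eta>, \<sigma>). subst (\<lambda>i. Const (\<eta> (\<sigma> i)) * Var (\<sigma> i)))"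

definition Gr1n_invariant :: "nat \<Rightarrow> nat \<Rightarrow> 'a::field mpoly set \<Rightarrow> bool" where
  "Gr1n_invariant r n I \<longleftrightarrow> (\<forall>g \<in> Gr1n r n. \<forall>f \<in> I. Gr1n_act g f \<in> I)"


section \<open>Specht ideals\<close>

text \<open>
  A partition is the weakly decreasing list of its (positive) parts, so that \<open>\<mu> \<turnstile> sum_list \<mu>\<close>.
  Cells are pairs (row, column), both counted from 0. For a one-row shape every column has a single
  cell, and the Specht polynomials are empty products.
\<close>

definition cells :: "nat list \<Rightarrow> (nat \<times> nat) set" where
  "cells \<mu> = {(a, c). a < length \<mu> \<and> c < \<mu> ! a}"

definition tableaux :: "nat list \<Rightarrow> (nat \<times> nat \<Rightarrow> nat) set" where
  "tableaux \<mu> = {T. bij_betw T (cells \<mu>) {1..sum_list \<mu>}}"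

definition specht_poly :: "nat list \<Rightarrow> (nat \<times> nat \<Rightarrow> nat) \<Rightarrow> 'a::field mpoly" where
  "specht_poly \<mu> T =
     (\<Prod>c \<in> snd ` cells \<mu>.
        \<Prod>(a, b) \<in> {(a, b). a < b \<and> (a, c) \<in> cells \<mu> \<and> (b, c) \<in> cells \<mu>}.
          Var (T (a, c)) - Var (T (b, c)))"

definition specht_ideal :: "nat list \<Rightarrow> 'a::field mpoly set" where
  "specht_ideal \<mu> = genideal (mpoly_ring (sum_list \<mu>)) (specht_poly \<mu> ` tableaux \<mu>)"

text \<open>
  The homomorphism $\phi_S$ sends $y_j$ to $x_{i_j}^r$, where $i_1 < i_2 < \dots$ are the elements
  of \<open>S\<close>.
\<close>

definition phi :: "nat \<Rightarrow> nat set \<Rightarrow> 'a::field mpoly \<Rightarrow> 'a mpoly" where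
  "phi r S = subst (\<lambda>j. Var (sorted_list_of_set S ! (j - 1)) ^ r)"

text \<open>
  \<open>sqfree_ideal n d\<close> is generated by the squarefree monomials of degree \<open>d\<close>; the ideal
  $I_{\ge z+1}$ is \<open>sqfree_ideal n (n - z)\<close>.
\<close>

definition sqfree_ideal :: "nat \<Rightarrow> nat \<Rightarrow> 'a::field mpoly set" where
  "sqfree_ideal n d = genideal (mpoly_ring n) {\<Prod>i\<in>A. Var i | A. A \<subseteq> {1..n} \<and> card A = d}"

text \<open>The ideal $I_{(\mu,z)}$ of $K[x_1,\dots,x_n]$, for \<open>z \<le> n\<close> and \<open>\<mu> \<turnstile> n - z\<close>.\<close>

definition gen_specht_ideal :: "nat \<Rightarrow> nat \<Rightarrow> nat list \<Rightarrow> nat \<Rightarrow> 'a::field mpoly set" where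
  "gen_specht_ideal r n \<mu> z =
     (\<Inter>S \<in> {S. S \<subseteq> {1..n} \<and> card S = n - z}.
        genideal (mpoly_ring n) (Var ` ({1..n} - S) \<union> phi r S ` specht_ideal \<mu>))
     \<inter> sqfree_ideal n (n - z)"

end

theory Submission
  imports Defs
begin

text \<open>
  Since $I_{(k)}$ is the unit ideal, $I_{((k),n-k)}$ is the ideal $J$ generated by the squarefree
  monomials of degree $k$. The ideal $J^q$ is contained in the span of the monomials $x^c$ with
  $\sum_l \min(c_l,q) \ge qk$, a condition that is superadditive in $q$. If $c_{\sigma(1)} \ge
  c_{\sigma(2)} \ge \dots$ and $c_{\sigma(i)} \le e_i$ for some $i \le j$, then
  $pk \le (i-1)p + (n-i+1)e_i$, which contradicts the choice of $p$; hence $x^c$ is divisible by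
  $\sigma \cdot m$.

  For minimality, let $i$ attain the maximum and let $q = p - 1$. The monomials having at least $i$
  exponents larger than $e_i$ span an invariant ideal containing $m$. Spreading $q$ cyclic
  intervals of length $k-i+1$ evenly over the variables $x_i,\dots,x_n$, and multiplying each of
  them by $x_1 \cdots x_{i-1}$, gives a monomial of $J^q$ in which only $x_1,\dots,x_{i-1}$ can
  occur with an exponent larger than $e_i$.
\<close>

section \<open>Monomials\<close>

lemma Var_power: "Var i ^ e = (Poly_Mapping.single (Poly_Mapping.single i e) 1 :: 'a::field mpoly)"
proof (induction e)
  case (Suc e)
  then show ?case
    by (simp add: Var_def mult_single flip: single_add)
qed (simp flip: single_one)

lemma Const_power: "Const a ^ e = (Const (a ^ e) :: 'a::field mpoly)"
  by (induction e) (simp_all add: Const_def mult_single flip: single_one)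

lemma prod_single:
  "(\<Prod>i\<in>A. Poly_Mapping.single (u i) (v i))
     = (Poly_Mapping.single (\<Sum>i\<in>A. u i) (\<Prod>i\<in>A. v i) :: 'a::field mpoly)"
  by (induction A rule: infinite_finite_induct) (simp_all add: mult_single flip: single_one)

lemma prod_Var_power:
  "(\<Prod>i\<in>A. Var i ^ w i)
     = (Poly_Mapping.single (\<Sum>i\<in>A. Poly_Mapping.single i (w i)) 1 :: 'a::field mpoly)"
  by (simp add: Var_power prod_single)

lemma lookup_sum_single:
  assumes "finite A"
  shows "Poly_Mapping.lookup (\<Sum>i\<in>A. Poly_Mapping.single i (w i)) l = (if l \<in> A then w l else (0::nat))"
  using assms by (simp add: lookup_sum lookup_single when_def)

text \<open>Each term goes to a scalar times a monomial, so the action of \<open>Gr1n\<close> can be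
  read off term by term. Images of different terms may collide, hence the sum runs over the old
  keys.\<close>

lemma subst_monomial_map:
  fixes f :: "'a::field mpoly"
  shows "subst (\<lambda>i. Const (h i) * Var (s i)) f =
    (\<Sum>c\<in>Poly_Mapping.keys f. Poly_Mapping.single
       (\<Sum>i\<in>Poly_Mapping.keys c. Poly_Mapping.single (s i) (Poly_Mapping.lookup c i))
       (Poly_Mapping.lookup f c * (\<Prod>i\<in>Poly_Mapping.keys c. h i ^ Poly_Mapping.lookup c i)))"
  unfolding subst_def
  by (simp add: power_mult_distrib Const_power Var_power)
     (simp add: Const_def mult_single prod_single)

text \<open>Injectivity of \<open>\<sigma>\<close> leaves only the summand \<open>i = l\<close> at
  position \<open>\<sigma> l\<close>; if \<open>l\<close> is not a key, both sides are 0.\<close>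

lemma lookup_permuted_exponents:
  assumes "bij \<sigma>"
  shows "Poly_Mapping.lookup (\<Sum>i\<in>Poly_Mapping.keys c. Poly_Mapping.single (\<sigma> i) (Poly_Mapping.lookup c i)) (\<sigma> l)
    = (Poly_Mapping.lookup c l :: nat)"
proof -
  have "\<sigma> i = \<sigma> l \<longleftrightarrow> i = l" for i
    using assms by (auto dest: bij_is_inj injD)
  then show ?thesis
    by (simp add: lookup_sum lookup_single when_def in_keys_iff)
qed

section \<open>Ideals spanned by monomials\<close>

lemma mpoly_ring_simps [simp]:
  "x \<otimes>\<^bsub>mpoly_ring n\<^esub> y = x * y" "x \<oplus>\<^bsub>mpoly_ring n\<^esub> y = x + y"
  "\<one>\<^bsub>mpoly_ring n\<^esub> = 1" "\<zero>\<^bsub>mpoly_ring n\<^esub> = 0"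
  by (simp_all add: mpoly_ring_def)

lemma carrier_mpoly_ring:
  "f \<in> carrier (mpoly_ring n) \<longleftrightarrow> (\<forall>c \<in> Poly_Mapping.keys f. Poly_Mapping.keys c \<subseteq> {1..n})"
  by (simp add: mpoly_ring_def)

lemma ring_mpoly_ring: "ring (mpoly_ring n :: 'a::field mpoly ring)"
proof (rule ringI)
  show "abelian_group (mpoly_ring n :: 'a mpoly ring)"
  proof (rule abelian_groupI, goal_cases)
    case (1 x y)
    then show ?case
      using keys_add[of x y] by (fastforce simp: carrier_mpoly_ring)
  next
    case (6 x)
    then show ?case
      by (intro bexI[of _ "- x"]) (auto simp: carrier_mpoly_ring)
  qed (auto simp: carrier_mpoly_ring algebra_simps)
  show "monoid (mpoly_ring n :: 'a mpoly ring)"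
  proof (rule monoidI, goal_cases)
    case (1 x y)
    show ?case
      unfolding carrier_mpoly_ring
    proof
      fix c assume "c \<in> Poly_Mapping.keys (x \<otimes>\<^bsub>mpoly_ring n\<^esub> y)"
      then obtain a b where "c = a + b" "a \<in> Poly_Mapping.keys x" "b \<in> Poly_Mapping.keys y"
        using keys_mult[of x y] by auto
      then show "Poly_Mapping.keys c \<subseteq> {1..n}"
        using 1 keys_add[of a b] by (fastforce simp: carrier_mpoly_ring)
    qed
  qed (auto simp: carrier_mpoly_ring algebra_simps)
qed (auto simp: algebra_simps)

text \<open>The monomials are selected by a predicate on exponent vectors, so that counting
  conditions can be plugged in directly. The span becomes an ideal once the predicate is upward
  closed.\<close>

definition monomial_span :: "nat \<Rightarrow> ((nat \<Rightarrow>\<^sub>0 nat) \<Rightarrow> bool) \<Rightarrow> 'a::field mpoly set" where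
  "monomial_span n P = {f \<in> carrier (mpoly_ring n). \<forall>c \<in> Poly_Mapping.keys f. P c}"

text \<open>Every exponent vector of a product is a sum of exponent vectors of the factors, so
  upward closure of \<open>P\<close> yields absorption.\<close>

lemma ideal_monomial_span:
  assumes up: "\<And>c d. P c \<Longrightarrow> P (c + d)"
  shows "ideal (monomial_span n P) (mpoly_ring n :: 'a::field mpoly ring)"
proof -
  interpret ring "mpoly_ring n :: 'a mpoly ring" by (rule ring_mpoly_ring)
  have minus: "\<ominus>\<^bsub>mpoly_ring n\<^esub> x = - x" if "x \<in> carrier (mpoly_ring n)" for x :: "'a mpoly"
    by (rule minus_equality) (use that in \<open>auto simp: carrier_mpoly_ring\<close>)
  have mult: "x * y \<in> monomial_span n P"
    if "x \<in> monomial_span n P" "y \<in> carrier (mpoly_ring n)" for x y :: "'a mpoly"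
  proof -
    have "P c" if "c \<in> Poly_Mapping.keys (x * y)" for c
      using that keys_mult[of x y] \<open>x \<in> monomial_span n P\<close> by (auto simp: monomial_span_def up)
    moreover have "x * y \<in> carrier (mpoly_ring n)"
      using m_closed[of x y] that by (auto simp: monomial_span_def)
    ultimately show ?thesis
      by (simp add: monomial_span_def)
  qed
  show ?thesis
  proof (rule idealI[OF ring_mpoly_ring])
    show "subgroup (monomial_span n P) (add_monoid (mpoly_ring n :: 'a mpoly ring))"
    proof (rule group.subgroupI, goal_cases)
      case 1
      show ?case by (rule a_group)
    next
      case 2
      show ?case by (auto simp: monomial_span_def)
    next
      case 3
      have "0 \<in> monomial_span n P" by (simp add: monomial_span_def carrier_mpoly_ring)
      then show ?case by auto
    next
      case (4 x)
      then show ?case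
        using minus[of x] by (auto simp: monomial_span_def a_inv_def carrier_mpoly_ring)
    next
      case (5 x y)
      then show ?case
        using keys_add[of x y] add.m_closed[of x y] by (auto simp: monomial_span_def)
    qed
  qed (use mult in \<open>auto simp: mult.commute\<close>)
qed

text \<open>A polynomial is the finite sum of its terms, so containment in an ideal can be tested on
  single terms.\<close>

lemma monomial_span_subset:
  fixes I :: "'a::field mpoly set"
  assumes I: "ideal I (mpoly_ring n)"
    and mono: "\<And>c a. P c \<Longrightarrow> Poly_Mapping.keys c \<subseteq> {1..n} \<Longrightarrow> Poly_Mapping.single c a \<in> I"
  shows "monomial_span n P \<subseteq> I"
proof
  interpret ideal I "mpoly_ring n" by (rule I)
  fix f :: "'a mpoly" assume f: "f \<in> monomial_span n P"
  have sums: "(\<Sum>c\<in>A. g c) \<in> I" if "finite A" "\<And>c. c \<in> A \<Longrightarrow> g c \<in> I"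
    for A and g :: "(nat \<Rightarrow>\<^sub>0 nat) \<Rightarrow> 'a mpoly"
    using that
  proof (induction A)
    case empty
    show ?case using additive_subgroup.zero_closed[OF is_additive_subgroup] by simp
  next
    case (insert c A)
    then show ?case
      using additive_subgroup.a_closed[OF is_additive_subgroup, of "g c" "\<Sum>c\<in>A. g c"] by simp
  qed
  have "(\<Sum>c\<in>Poly_Mapping.keys f. Poly_Mapping.single c (Poly_Mapping.lookup f c)) = f"
    by (rule poly_mapping_eqI) (simp add: lookup_sum lookup_single when_def in_keys_iff)
  moreover have "(\<Sum>c\<in>Poly_Mapping.keys f. Poly_Mapping.single c (Poly_Mapping.lookup f c)) \<in> I"
    using f by (intro sums mono) (auto simp: monomial_span_def carrier_mpoly_ring)
  ultimately show "f \<in> I" by simp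
qed

lemma single_in_ideal:
  fixes I :: "'a::field mpoly set"
  assumes "ideal I (mpoly_ring n)" and "Poly_Mapping.single w 1 \<in> I"
    and "Poly_Mapping.keys c \<subseteq> {1..n}"
    and le: "\<And>l. Poly_Mapping.lookup w l \<le> Poly_Mapping.lookup c l"
  shows "Poly_Mapping.single c a \<in> I"
proof -
  interpret ideal I "mpoly_ring n" by fact
  \<comment> \<open>Subtraction truncates at 0 in each coordinate; \<open>le\<close> ensures that
    nothing is lost.\<close>
  have "c = (c - w) + w"
    using le by (intro poly_mapping_eqI) (simp add: lookup_add lookup_minus)
  then have eq: "Poly_Mapping.single c a = Poly_Mapping.single (c - w) a * Poly_Mapping.single w 1"
    by (metis mult_single mult.right_neutral)
  have "Poly_Mapping.keys (c - w) \<subseteq> Poly_Mapping.keys c"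
    by (auto simp: in_keys_iff lookup_minus)
  then have "Poly_Mapping.single (c - w) a \<in> carrier (mpoly_ring n)"
    using assms(3) by (auto simp: carrier_mpoly_ring)
  from I_l_closed[OF assms(2) this] show ?thesis by (simp add: eq)
qed

text \<open>\<open>\<eta>\<close> only rescales coefficients while \<open>\<sigma>\<close> moves
  exponents, so stability of \<open>P\<close> under this one permutation is enough.\<close>

lemma Gr1n_act_monomial_span:
  fixes f :: "'a::field mpoly"
  assumes \<sigma>: "\<sigma> permutes {1..n}" and f: "f \<in> monomial_span n P"
    and perm: "\<And>c d. P c \<Longrightarrow> (\<And>l. Poly_Mapping.lookup d (\<sigma> l) = Poly_Mapping.lookup c l) \<Longrightarrow> P d"
  shows "Gr1n_act (\<eta>, \<sigma>) f \<in> monomial_span n P"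
proof -
  define T where "T c = (\<Sum>i\<in>Poly_Mapping.keys c. Poly_Mapping.single (\<sigma> i) (Poly_Mapping.lookup c i))"
    for c :: "nat \<Rightarrow>\<^sub>0 nat"
  have lookup_T: "Poly_Mapping.lookup (T c) (\<sigma> l) = Poly_Mapping.lookup c l" for c l
    unfolding T_def using \<sigma> by (intro lookup_permuted_exponents permutes_bij)
  have keys_T: "Poly_Mapping.keys (T c) \<subseteq> {1..n}" if "Poly_Mapping.keys c \<subseteq> {1..n}" for c
  proof
    fix l assume "l \<in> Poly_Mapping.keys (T c)"
    moreover obtain l' where "l = \<sigma> l'" using \<sigma> by (metis permutes_surj surjD)
    ultimately have "l' \<in> Poly_Mapping.keys c"
      by (simp add: in_keys_iff lookup_T)
    then show "l \<in> {1..n}"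
      using that permutes_in_image[OF \<sigma>] \<open>l = \<sigma> l'\<close> by blast
  qed
  \<comment> \<open>Terms may vanish for arbitrary \<open>\<eta>\<close>, so only an inclusion of
    keys is claimed; it suffices.\<close>
  have "\<exists>c \<in> Poly_Mapping.keys f. d = T c" if "d \<in> Poly_Mapping.keys (Gr1n_act (\<eta>, \<sigma>) f)" for d
    using that keys_sum unfolding Gr1n_act_def prod.case subst_monomial_map T_def
    by (fastforce split: if_splits)
  then show ?thesis
    using f keys_T perm lookup_T unfolding monomial_span_def carrier_mpoly_ring by blast
qed

section \<open>The ideal for the one-row shape\<close>

text \<open>No column has two cells, so every generator is an empty product. Equal cardinalities of
  cells and labels provide a tableau, hence a generator.\<close>

lemma one_in_specht_ideal_one_row: "1 \<in> (specht_ideal [k] :: 'a::field mpoly set)"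
proof -
  have "cells [k] = (\<lambda>c. (0, c)) ` {..<k}"
    by (auto simp: cells_def)
  then have fin: "finite (cells [k])" and card: "card (cells [k]) = card {1..sum_list [k]}"
    by (auto simp: card_image inj_on_def)
  then obtain T where T: "T \<in> tableaux [k]"
    using finite_same_card_bij[OF fin _ card] by (auto simp: tableaux_def)
  have "specht_poly [k] T = (1 :: 'a mpoly)"
    unfolding specht_poly_def
    by (intro prod.neutral ballI) (auto simp: cells_def)
  then have "1 \<in> (specht_poly [k] ` tableaux [k] :: 'a mpoly set)"
    using T by force
  then show ?thesis
    unfolding specht_ideal_def genideal_def by blast
qed

text \<open>Each ideal in the intersection over \<open>S\<close> contains the image of 1 and is
  therefore the whole ring; only the squarefree ideal remains, of degree
  \<open>n - (n - k) = k\<close>.\<close>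

lemma gen_specht_ideal_one_row:
  assumes "k \<le> n"
  shows "gen_specht_ideal r n [k] (n - k) = (sqfree_ideal n k :: 'a::field mpoly set)"
proof -
  have gen: "carrier (mpoly_ring n) \<subseteq> genideal (mpoly_ring n) (V \<union> phi r S ` specht_ideal [k])"
    for S and V :: "'a mpoly set"
  proof -
    have "phi r S 1 = (1 :: 'a mpoly)"
      by (simp add: phi_def subst_def Const_def flip: single_one)
    then have "1 \<in> phi r S ` (specht_ideal [k] :: 'a mpoly set)"
      using one_in_specht_ideal_one_row by (metis imageI)
    then have "I = carrier (mpoly_ring n)"
      if "ideal I (mpoly_ring n)" "V \<union> phi r S ` specht_ideal [k] \<subseteq> I" for I
      using that by (intro ideal.one_imp_carrier) auto
    then show ?thesis
      unfolding genideal_def by blast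
  qed
  \<comment> \<open>\<open>genideal\<close> is an intersection of ideals, so it lies in the carrier
    as soon as one ideal inside the carrier contains the generators. The span of all monomials is
    such an ideal.\<close>
  have "\<exists>T. ideal T (mpoly_ring n) \<and> {\<Prod>i\<in>A. Var i | A. A \<subseteq> {1..n} \<and> card A = k} \<subseteq> T
      \<and> T \<subseteq> (carrier (mpoly_ring n) :: 'a mpoly set)"
  proof (intro exI conjI)
    show "ideal (monomial_span n (\<lambda>_. True)) (mpoly_ring n :: 'a mpoly ring)"
      by (rule ideal_monomial_span) simp
    show "{\<Prod>i\<in>A. Var i | A. A \<subseteq> {1..n} \<and> card A = k} \<subseteq> (monomial_span n (\<lambda>_. True) :: 'a mpoly set)"
    proof clarify
      fix A assume "A \<subseteq> {1..n}"
      moreover from this have "finite A" by (rule finite_subset) simp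
      ultimately show "(\<Prod>i\<in>A. Var i :: 'a mpoly) \<in> monomial_span n (\<lambda>_. True)"
        using prod_Var_power[of "\<lambda>_. 1" A, where 'a='a]
        by (auto simp: monomial_span_def carrier_mpoly_ring in_keys_iff lookup_sum_single split: if_splits)
    qed
  qed (auto simp: monomial_span_def)
  then have "sqfree_ideal n k \<subseteq> (carrier (mpoly_ring n) :: 'a mpoly set)"
    unfolding sqfree_ideal_def genideal_def by blast
  then show ?thesis
    unfolding gen_specht_ideal_def using gen assms by fastforce
qed

section \<open>Powers of the ideal generated by squarefree monomials\<close>

lemma ideal_power_0: "ideal_power n J 0 = carrier (mpoly_ring n)"
  by (simp add: ideal_power_def ideals_set_def nat_pow_def)

lemma ideal_power_Suc: "ideal_power n J (Suc q) = ideal_prod (mpoly_ring n) (ideal_power n J q) J"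
  by (simp add: ideal_power_def ideals_set_def nat_pow_def)

text \<open>A product of \<open>q\<close> squarefree monomials of degree \<open>k\<close> has total
  degree \<open>q * k\<close> and no exponent above \<open>q\<close>; hence capping the exponents of
  any multiple of it at \<open>q\<close> leaves a sum of at least \<open>q * k\<close>.\<close>

definition covers :: "nat \<Rightarrow> nat \<Rightarrow> nat \<Rightarrow> (nat \<Rightarrow>\<^sub>0 nat) \<Rightarrow> bool" where
  "covers n k q c \<longleftrightarrow> q * k \<le> (\<Sum>l\<in>{1..n}. min (Poly_Mapping.lookup c l) q)"

lemma covers_add: "covers n k q c \<Longrightarrow> covers n k q (c + d)"
  unfolding covers_def by (erule order_trans) (auto intro!: sum_mono simp: lookup_add)

text \<open>Sum the inequality \<open>min a q + min b 1 \<le> min (a + b) (Suc q)\<close> over the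
  variables.\<close>

lemma covers_add_Suc:
  assumes "covers n k q c" "covers n k 1 d"
  shows "covers n k (Suc q) (c + d)"
proof -
  have "(\<Sum>l\<in>{1..n}. min (Poly_Mapping.lookup c l) q) + (\<Sum>l\<in>{1..n}. min (Poly_Mapping.lookup d l) 1)
     \<le> (\<Sum>l\<in>{1..n}. min (Poly_Mapping.lookup (c + d) l) (Suc q))"
    unfolding sum.distrib[symmetric] by (rule sum_mono) (auto simp: lookup_add)
  with assms show ?thesis
    by (simp add: covers_def)
qed

lemma sqfree_ideal_subset: "sqfree_ideal n k \<subseteq> (monomial_span n (covers n k 1) :: 'a::field mpoly set)"
proof -
  have "(\<Prod>i\<in>A. Var i :: 'a mpoly) \<in> monomial_span n (covers n k 1)"
    if A: "A \<subseteq> {1..n}" "card A = k" for A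
  proof -
    have fin: "finite A" using A(1) by (rule finite_subset) simp
    have "k = (\<Sum>l\<in>{1..n}. if l \<in> A then 1 else (0::nat))"
      using A by (simp add: sum.If_cases Int_absorb1)
    then have "covers n k 1 (\<Sum>i\<in>A. Poly_Mapping.single i 1)"
      unfolding covers_def lookup_sum_single[OF fin] by (auto intro!: sum_mono)
    then show ?thesis
      using A fin prod_Var_power[of "\<lambda>_. 1" A, where 'a='a]
      by (auto simp: monomial_span_def carrier_mpoly_ring in_keys_iff lookup_sum_single
          split: if_splits)
  qed
  then have "{\<Prod>i\<in>A. Var i | A. A \<subseteq> {1..n} \<and> card A = k} \<subseteq> (monomial_span n (covers n k 1) :: 'a mpoly set)"
    by blast
  moreover have "ideal (monomial_span n (covers n k 1)) (mpoly_ring n :: 'a mpoly ring)"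
    by (rule ideal_monomial_span) (rule covers_add)
  ultimately show ?thesis
    unfolding sqfree_ideal_def genideal_def by blast
qed

text \<open>Induction on \<open>q\<close>. Elements of \<open>ideal_prod\<close> arise from
  products, where exponents add and \<open>covers_add_Suc\<close> applies, and from sums, under
  which the target span is closed.\<close>

lemma sqfree_ideal_power_subset:
  "ideal_power n (sqfree_ideal n k) q \<subseteq> (monomial_span n (covers n k q) :: 'a::field mpoly set)"
proof (induction q)
  case 0
  then show ?case
    by (auto simp: ideal_power_0 monomial_span_def covers_def)
next
  case (Suc q)
  interpret R: ring "mpoly_ring n :: 'a mpoly ring" by (rule ring_mpoly_ring)
  have T: "ideal (monomial_span n (covers n k (Suc q))) (mpoly_ring n :: 'a mpoly ring)"
    by (rule ideal_monomial_span) (rule covers_add)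
  show ?case
  proof
    fix f :: "'a mpoly" assume "f \<in> ideal_power n (sqfree_ideal n k) (Suc q)"
    then have "f \<in> ideal_prod (mpoly_ring n) (ideal_power n (sqfree_ideal n k) q) (sqfree_ideal n k)"
      by (simp add: ideal_power_Suc)
    then show "f \<in> monomial_span n (covers n k (Suc q))"
    proof induction
      case (prod x y)
      then have x: "x \<in> monomial_span n (covers n k q)" and y: "y \<in> monomial_span n (covers n k 1)"
        using Suc sqfree_ideal_subset by auto
      then have "x \<in> carrier (mpoly_ring n)" "y \<in> carrier (mpoly_ring n)"
        unfolding monomial_span_def by blast+
      from R.m_closed[OF this] have "x * y \<in> carrier (mpoly_ring n)"
        by (simp only: mpoly_ring_simps)
      moreover have "covers n k (Suc q) c" if c: "c \<in> Poly_Mapping.keys (x * y)" for c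
      proof -
        obtain a b where "c = a + b" "a \<in> Poly_Mapping.keys x" "b \<in> Poly_Mapping.keys y"
          using c keys_mult[of x y] by blast
        then show ?thesis
          using x y covers_add_Suc unfolding monomial_span_def by blast
      qed
      ultimately show ?case
        unfolding monomial_span_def by simp
    next
      case (sum x y)
      then show ?case
        using additive_subgroup.a_closed[OF ideal.axioms(1)[OF T]] by (metis mpoly_ring_simps(2))
    qed
  qed
qed

lemma prod_in_ideal_power:
  assumes "\<And>t. t < q \<Longrightarrow> M t \<in> J"
  shows "(\<Prod>t<q. M t) \<in> ideal_power n J q"
  using assms
proof (induction q)
  case 0
  then show ?case by (auto simp: ideal_power_0 carrier_mpoly_ring)
next
  case (Suc q)
  then show ?case
    using ideal_prod.prod[of "\<Prod>t<q. M t" "ideal_power n J q" "M q" J "mpoly_ring n"]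
    by (simp add: ideal_power_Suc)
qed

lemma prod_Var_in_sqfree_ideal:
  assumes "A \<subseteq> {1..n}" "card A = k"
  shows "(\<Prod>i\<in>A. Var i) \<in> sqfree_ideal n k"
  using assms unfolding sqfree_ideal_def genideal_def by blast

section \<open>Counting exponents\<close>

lemma decreasing_rearrangement:
  fixes c :: "nat \<Rightarrow> 'b::linorder"
  obtains \<sigma> where "\<sigma> permutes {1..n}"
    and "\<And>i l. 1 \<le> i \<Longrightarrow> i \<le> l \<Longrightarrow> l \<le> n \<Longrightarrow> c (\<sigma> l) \<le> c (\<sigma> i)"
proof
  define xs where "xs = rev (sort_key c [1..<Suc n])"
  \<comment> \<open>List positions start at 0, hence \<open>i - 1\<close>; the identity outside
    \<open>{1..n}\<close> is what \<open>permutes\<close> demands.\<close>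
  define \<sigma> where "\<sigma> i = (if i \<in> {1..n} then xs ! (i - 1) else i)" for i
  have len: "length xs = n" and dist: "distinct xs" and set: "set xs = {1..n}"
    by (auto simp: xs_def)
  have sorted: "sorted (rev (map c xs))"
    by (simp add: xs_def rev_map[symmetric])
  have "inj_on \<sigma> {1..n}"
    using dist len by (auto simp: inj_on_def \<sigma>_def nth_eq_iff_index_eq)
  moreover have "\<sigma> ` {1..n} \<subseteq> {1..n}"
    using set len by (force simp: \<sigma>_def dest: nth_mem)
  ultimately have "bij_betw \<sigma> {1..n} {1..n}"
    by (simp add: bij_betw_def endo_inj_surj)
  then show "\<sigma> permutes {1..n}"
    by (rule bij_imp_permutes) (auto simp: \<sigma>_def)
  fix i l assume "1 \<le> i" "i \<le> l" "l \<le> n"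
  then show "c (\<sigma> l) \<le> c (\<sigma> i)"
    using sorted_rev_nth_mono[OF sorted, of "i - 1" "l - 1"] len by (simp add: \<sigma>_def)
qed

text \<open>The bound \<open>w\<close> is kept free so that the lemma serves both \<open>e i\<close>
  for \<open>i \<le> j\<close> and the value 0 for \<open>j < i \<le> k\<close>. Otherwise the
  \<open>i - 1\<close> largest exponents, capped at \<open>p\<close>, and the others, at most
  \<open>w\<close>, would sum to less than \<open>p * k\<close>.\<close>

lemma covers_imp_large_exponent:
  assumes cov: "covers n k p c" and \<sigma>: "\<sigma> permutes {1..n}"
    and dec: "\<And>l. i \<le> l \<Longrightarrow> l \<le> n \<Longrightarrow> Poly_Mapping.lookup c (\<sigma> l) \<le> Poly_Mapping.lookup c (\<sigma> i)"
    and "1 \<le> i" "i \<le> k" "k \<le> n"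
    and large: "(n - i + 1) * w < p * (k - i + 1)"
  shows "w < Poly_Mapping.lookup c (\<sigma> i)"
proof (rule ccontr)
  assume "\<not> ?thesis"
  then have small: "Poly_Mapping.lookup c (\<sigma> l) \<le> w" if "l \<in> {i..n}" for l
    using dec[of l] that by force
  have "p * k \<le> (\<Sum>l\<in>{1..n}. min (Poly_Mapping.lookup c (\<sigma> l)) p)"
    using cov sum.permute[OF \<sigma>, of "\<lambda>l. min (Poly_Mapping.lookup c l) p"]
    by (simp add: covers_def o_def)
  also have "{1..n} = {1..<i} \<union> {i..n}"
    using assms by auto
  also have "(\<Sum>l\<in>{1..<i} \<union> {i..n}. min (Poly_Mapping.lookup c (\<sigma> l)) p)
      = (\<Sum>l\<in>{1..<i}. min (Poly_Mapping.lookup c (\<sigma> l)) p)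
        + (\<Sum>l\<in>{i..n}. min (Poly_Mapping.lookup c (\<sigma> l)) p)"
    by (rule sum.union_disjoint) auto
  also have "\<dots> \<le> (\<Sum>l\<in>{1..<i}. p) + (\<Sum>l\<in>{i..n}. w)"
    by (intro add_mono sum_mono) (use small in \<open>auto simp: min_le_iff_disj\<close>)
  also have "\<dots> = (i - 1) * p + (n - i + 1) * w"
    using assms by (simp add: Suc_diff_le)
  also have "\<dots> < (i - 1) * p + p * (k - i + 1)"
    using large by simp
  also have "\<dots> = p * (i - 1 + (k - i + 1))"
    by (simp only: distrib_left mult.commute)
  also have "i - 1 + (k - i + 1) = k"
    using assms by simp
  finally show False by simp
qed

text \<open>Lay the \<open>q\<close> intervals of length \<open>L\<close> end to end and wind them
  around a cycle of length \<open>N\<close>. They make at most \<open>e\<close> turns, so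
  \<open>r\<close> is met only at positions \<open>r + v * N\<close> with \<open>v < e\<close>, and
  each position lies in a single interval.\<close>

lemma card_cyclic_intervals_through_point:
  fixes N L q e r :: nat
  assumes "q * L \<le> N * e"
  shows "card {t \<in> {..<q}. \<exists>s<L. (t * L + s) mod N = r} \<le> e"
proof -
  have "{t \<in> {..<q}. \<exists>s<L. (t * L + s) mod N = r} \<subseteq> (\<lambda>v. (r + v * N) div L) ` {..<e}"
  proof clarify
    fix t s assume t: "t < q" and s: "s < L" and r: "r = (t * L + s) mod N"
    let ?u = "t * L + s"
    have "?u < Suc t * L" using s by simp
    also have "\<dots> \<le> q * L" using t by (intro mult_le_mono1) simp
    also have "\<dots> \<le> N * e" by fact
    finally have "?u div N < e"
      by (simp add: less_mult_imp_div_less mult.commute)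
    \<comment> \<open>The position \<open>?u\<close> is rebuilt from its residue and its turn
      \<open>?u div N\<close>; dividing by \<open>L\<close> recovers \<open>t\<close> because
      \<open>s < L\<close>.\<close>
    moreover have "t = ((?u mod N) + ?u div N * N) div L"
      using s by simp
    ultimately show "t \<in> (\<lambda>v. (?u mod N + v * N) div L) ` {..<e}"
      by blast
  qed
  from card_mono[OF _ this] show ?thesis
    using card_image_le[of "{..<e}" "\<lambda>v. (r + v * N) div L"] by simp
qed

text \<open>Two offsets below \<open>L \<le> N\<close> differ by less than \<open>N\<close>, so
  congruence modulo \<open>N\<close> forces equality.\<close>

lemma inj_on_cyclic_interval:
  fixes N L a :: nat
  assumes "L \<le> N"
  shows "inj_on (\<lambda>s. (a + s) mod N) {..<L}"
proof (rule inj_onI)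
  have *: "s = s'" if "s \<le> s'" "s' < L" "(a + s) mod N = (a + s') mod N" for s s'
  proof -
    have "N dvd (a + s') - (a + s)"
      using that by (subst mod_eq_dvd_iff_nat[symmetric]) auto
    then have "N dvd s' - s" by simp
    then show ?thesis
      using that assms by (auto dest: dvd_imp_le)
  qed
  fix s s' assume "s \<in> {..<L}" "s' \<in> {..<L}" "(a + s) mod N = (a + s') mod N"
  then show "s = s'"
    using *[of s s'] *[of s' s] by (cases "s \<le> s'") auto
qed

text \<open>The variables before \<open>i\<close> occur in all \<open>q\<close> factors and their
  exponents are left free. For \<open>l \<ge> i\<close> the exponent is the number of cyclic
  intervals through one point.\<close>

lemma exists_flat_monomial_in_power:
  assumes "1 \<le> i" "i \<le> k" "k \<le> n" and q: "q * (k - i + 1) \<le> (n - i + 1) * e"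
  obtains c where "Poly_Mapping.single c (1::'a::field) \<in> ideal_power n (sqfree_ideal n k) q"
    and "\<And>l. i \<le> l \<Longrightarrow> l \<le> n \<Longrightarrow> Poly_Mapping.lookup c l \<le> e"
proof -
  define N L where "N = n - i + 1" and "L = k - i + 1"
  have NL: "0 < N" "L \<le> N" using assms by (auto simp: N_def L_def)
  \<comment> \<open>Residues modulo \<open>N\<close> are shifted to the variables from
    \<open>i\<close> to \<open>n\<close>. Starting interval \<open>t\<close> at \<open>t * L\<close>
    makes successive intervals abut, which spreads them evenly.\<close>
  define B where "B t = (\<lambda>s. i + (t * L + s) mod N) ` {..<L}" for t
  define A where "A t = {1..<i} \<union> B t" for t
  have "inj_on (\<lambda>s. i + (t * L + s) mod N) {..<L}" for t
    using inj_on_cyclic_interval[OF NL(2), of "t * L"] by (auto simp: inj_on_def)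
  then have "card (B t) = L" for t
    unfolding B_def by (simp add: card_image)
  moreover have B_ge: "B t \<subseteq> {i..n}" for t
  proof -
    have "(t * L + s) mod N \<le> n - i" for s
      using mod_less_divisor[OF NL(1), of "t * L + s"] by (simp add: N_def)
    moreover have "i \<le> n" using assms by simp
    ultimately show ?thesis by (auto simp: B_def le_diff_conv2 add.commute)
  qed
  moreover have "{1..<i} \<inter> B t = {}" for t
    using B_ge[of t] by fastforce
  ultimately have "card (A t) = k" for t
    using assms by (simp add: A_def L_def card_Un_disjoint B_def)
  moreover have "A t \<subseteq> {1..n}" for t
    using B_ge[of t] assms by (auto simp: A_def)
  ultimately have "(\<Prod>l\<in>A t. Var l :: 'a mpoly) \<in> sqfree_ideal n k" for t
    by (simp add: prod_Var_in_sqfree_ideal)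
  then have "(\<Prod>t<q. \<Prod>l\<in>A t. Var l :: 'a mpoly) \<in> ideal_power n (sqfree_ideal n k) q"
    by (rule prod_in_ideal_power)
  moreover define c where "c = (\<Sum>t<q. \<Sum>l\<in>A t. Poly_Mapping.single l (1::nat))"
  have "(\<Prod>t<q. \<Prod>l\<in>A t. Var l :: 'a mpoly) = Poly_Mapping.single c 1"
    using prod_Var_power[of "\<lambda>_. 1", where 'a='a] by (simp add: prod_single c_def)
  moreover have "Poly_Mapping.lookup c l \<le> e" if "i \<le> l" "l \<le> n" for l
  proof -
    have fin: "finite (A t)" for t by (simp add: A_def B_def)
    have "Poly_Mapping.lookup c l = card {t \<in> {..<q}. l \<in> A t}"
      unfolding c_def lookup_sum[of _ "{..<q}"]
      by (simp add: lookup_sum_single[OF fin] sum.If_cases Int_def)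
    \<comment> \<open>As \<open>i \<le> l\<close>, membership in \<open>A t\<close> can only come
      from \<open>B t\<close>, and the shift by \<open>i\<close> turns \<open>l\<close> into the
      residue \<open>l - i\<close>.\<close>
    also have "{t \<in> {..<q}. l \<in> A t} = {t \<in> {..<q}. \<exists>s<L. (t * L + s) mod N = l - i}"
      using that by (force simp: A_def B_def image_iff)
    also have "card \<dots> \<le> e"
      using q by (intro card_cyclic_intervals_through_point) (simp add: N_def L_def)
    finally show ?thesis .
  qed
  ultimately show ?thesis
    using that by metis
qed

theorem theorem5p3:
  fixes r n k j p :: nat and e :: "nat \<Rightarrow> nat" and m :: "'a::field mpoly"
  assumes "infinite (UNIV :: 'a set)"
    and "r \<ge> 2" and "contains_roots_of_unity TYPE('a) r"
    and "1 \<le> j" and "j \<le> k" and "k \<le> n"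
    and "\<forall>i. 1 \<le> i \<and> i < j \<longrightarrow> e i \<ge> e (i + 1)" and "e j \<ge> 1"
    and "m = (\<Prod>i=1..j. Var i ^ (1 + e i)) * (\<Prod>i=j+1..k. Var i)"
    and "p = 1 + (MAX i\<in>{1..j}. ((n - i + 1) * e i) div (k - i + 1))"
  shows "(\<forall>I. ideal I (mpoly_ring n) \<and> Gr1n_invariant r n I \<and> m \<in> I \<longrightarrow>
             ideal_power n (gen_specht_ideal r n [k] (n - k)) p \<subseteq> I) \<and>
         (\<exists>I. ideal I (mpoly_ring n) \<and> Gr1n_invariant r n I \<and> m \<in> I \<and>
             \<not> ideal_power n (gen_specht_ideal r n [k] (n - k)) (p - 1) \<subseteq> I)"
proof -
  \<comment> \<open>One formula for all exponents of \<open>m\<close>: beyond \<open>j\<close> it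
    amounts to setting \<open>e i\<close> to 0.\<close>
  define w where "w i = (if i \<le> j then 1 + e i else 1)" for i
  define M where "M = (\<Sum>i\<in>{1..k}. Poly_Mapping.single i (w i))"
  have lookup_M: "Poly_Mapping.lookup M l = (if l \<in> {1..k} then w l else 0)" for l
    unfolding M_def by (simp add: lookup_sum_single)
  have "{1..k} = {1..j} \<union> {j+1..k}"
    using assms by auto
  then have "(\<Prod>i=1..k. Var i ^ w i :: 'a mpoly) = (\<Prod>i=1..j. Var i ^ w i) * (\<Prod>i=j+1..k. Var i ^ w i)"
    by (simp add: prod.union_disjoint)
  also have "\<dots> = m"
    unfolding assms(9) by (intro arg_cong2[where f = "(*)"] prod.cong) (auto simp: w_def)
  finally have m: "m = Poly_Mapping.single M 1"
    by (simp add: M_def prod_Var_power)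
  let ?F = "\<lambda>i. ((n - i + 1) * e i) div (k - i + 1)"
  have J: "gen_specht_ideal r n [k] (n - k) = (sqfree_ideal n k :: 'a mpoly set)"
    using assms by (intro gen_specht_ideal_one_row)

  \<comment> \<open>Containment of the \<open>p\<close>-th power\<close>
  have "ideal_power n (sqfree_ideal n k) p \<subseteq> I"
    if I: "ideal I (mpoly_ring n)" and inv: "Gr1n_invariant r n I" and mI: "m \<in> I" for I :: "'a mpoly set"
  proof -
    have "Poly_Mapping.single c a \<in> I"
      if cov: "covers n k p c" and c: "Poly_Mapping.keys c \<subseteq> {1..n}" for c and a :: 'a
    proof -
      obtain \<sigma> where \<sigma>: "\<sigma> permutes {1..n}"
        and dec: "\<And>i l. 1 \<le> i \<Longrightarrow> i \<le> l \<Longrightarrow> l \<le> n \<Longrightarrow>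
          Poly_Mapping.lookup c (\<sigma> l) \<le> Poly_Mapping.lookup c (\<sigma> i)"
        using decreasing_rearrangement[of n "Poly_Mapping.lookup c"] by blast
      have w_le: "w i \<le> Poly_Mapping.lookup c (\<sigma> i)" if i: "i \<in> {1..k}" for i
      proof -
        \<comment> \<open>For \<open>i \<le> j\<close> this unfolds the fact that \<open>p\<close>
          exceeds the quotient \<open>?F i\<close>; for \<open>i > j\<close> the left side is 0 and
          the right side is positive.\<close>
        have "(n - i + 1) * (w i - 1) < p * (k - i + 1)"
        proof (cases "i \<le> j")
          case True
          then have "?F i \<le> (MAX i\<in>{1..j}. ?F i)"
            using i by (intro Max_ge) auto
          then have "?F i < p"
            by (simp only: assms(10) less_Suc_eq_le plus_1_eq_Suc)
          then show ?thesis
            using True by (simp add: w_def div_less_iff_less_mult)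
        next
          case False
          then show ?thesis using assms(10) by (simp add: w_def)
        qed
        then have "w i - 1 < Poly_Mapping.lookup c (\<sigma> i)"
          using covers_imp_large_exponent[OF cov \<sigma>] dec i assms by auto
        then show ?thesis by simp
      qed
      define M' where
        "M' = (\<Sum>i\<in>Poly_Mapping.keys M. Poly_Mapping.single (\<sigma> i) (Poly_Mapping.lookup M i))"
      have M': "Poly_Mapping.lookup M' (\<sigma> l) = Poly_Mapping.lookup M l" for l
        unfolding M'_def using \<sigma> by (intro lookup_permuted_exponents permutes_bij)
      \<comment> \<open>Only the permutation is wanted, so all roots of unity are 1. The restriction
        makes \<open>\<eta>\<close> extensional, as \<open>Gr1n\<close> requires.\<close>
      define \<eta> where "\<eta> = (\<lambda>i\<in>{1..n}. 1 :: 'a)"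
      have "(\<eta>, \<sigma>) \<in> Gr1n r n"
        using \<sigma> by (auto simp: Gr1n_def roots_of_unity_def \<eta>_def)
      then have "Gr1n_act (\<eta>, \<sigma>) m \<in> I"
        using inv mI by (auto simp: Gr1n_invariant_def)
      \<comment> \<open>Outside \<open>{1..n}\<close> the value of \<open>\<eta>\<close> is
        \<open>undefined\<close>, so it matters that \<open>\<sigma>\<close> keeps the keys of
        \<open>M\<close> inside.\<close>
      moreover have "(\<Prod>i\<in>Poly_Mapping.keys M. \<eta> (\<sigma> i) ^ Poly_Mapping.lookup M i) = 1"
      proof (rule prod.neutral, rule ballI)
        fix i assume "i \<in> Poly_Mapping.keys M"
        then have "i \<in> {1..n}"
          using assms by (auto simp: in_keys_iff lookup_M split: if_splits)
        then have "\<sigma> i \<in> {1..n}"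
          using \<sigma> by (simp only: permutes_in_image)
        then show "\<eta> (\<sigma> i) ^ Poly_Mapping.lookup M i = 1"
          by (simp add: \<eta>_def)
      qed
      ultimately have "Poly_Mapping.single M' 1 \<in> I"
        by (simp add: Gr1n_act_def subst_monomial_map m M'_def)
      moreover have "Poly_Mapping.lookup M' l \<le> Poly_Mapping.lookup c l" for l
      proof -
        obtain l' where "l = \<sigma> l'" using \<sigma> by (metis permutes_surj surjD)
        then show ?thesis using w_le[of l'] by (simp add: M' lookup_M)
      qed
      ultimately show ?thesis
        by (rule single_in_ideal[OF I _ c])
    qed
    from monomial_span_subset[OF I this] sqfree_ideal_power_subset show ?thesis
      by blast
  qed

  \<comment> \<open>Minimality of \<open>p\<close>\<close>
  moreover have "\<exists>I. ideal I (mpoly_ring n) \<and> Gr1n_invariant r n I \<and> m \<in> I \<and>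
    \<not> ideal_power n (sqfree_ideal n k) (p - 1) \<subseteq> I"
  proof -
    have "(MAX i\<in>{1..j}. ?F i) \<in> ?F ` {1..j}"
      using assms by (intro Max_in) auto
    then obtain i where i: "1 \<le> i" "i \<le> j" and pi: "p - 1 = ?F i"
      using assms(10) by auto
    define P where "P c \<longleftrightarrow> i \<le> card {l \<in> {1..n}. e i < Poly_Mapping.lookup c l}"
      for c :: "nat \<Rightarrow>\<^sub>0 nat"
    define I :: "'a mpoly set" where "I = monomial_span n P"
    have "P (c + d)" if "P c" for c d
      using that unfolding P_def
      by (rule order_trans) (auto intro!: card_mono simp: lookup_add)
    then have ideal: "ideal I (mpoly_ring n)"
      unfolding I_def by (rule ideal_monomial_span)
    have "P d" if \<sigma>: "\<sigma> permutes {1..n}" and "P c"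
      and d: "\<And>l. Poly_Mapping.lookup d (\<sigma> l) = Poly_Mapping.lookup c l" for \<sigma> c d
    proof -
      have "\<sigma> ` {l \<in> {1..n}. e i < Poly_Mapping.lookup c l} \<subseteq> {l \<in> {1..n}. e i < Poly_Mapping.lookup d l}"
      proof clarify
        fix l assume "l \<in> {1..n}" "e i < Poly_Mapping.lookup c l"
        then show "\<sigma> l \<in> {1..n} \<and> e i < Poly_Mapping.lookup d (\<sigma> l)"
          by (simp only: d permutes_in_image[OF \<sigma>] simp_thms)
      qed
      from card_mono[OF _ this] show ?thesis
        using \<open>P c\<close> \<sigma> by (simp add: P_def card_image permutes_inj_on)
    qed
    then have "Gr1n_act (\<eta>, \<sigma>) f \<in> I" if "\<sigma> permutes {1..n}" "f \<in> I" for \<eta> \<sigma> f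
      using Gr1n_act_monomial_span[of \<sigma> n f P \<eta>] that unfolding I_def by blast
    then have inv: "Gr1n_invariant r n I"
      unfolding Gr1n_invariant_def Gr1n_def by blast
    \<comment> \<open>Monotonicity is assumed only for neighbouring indices, so \<open>l\<close>
      descends from \<open>i\<close>.\<close>
    have e_mono: "e i \<le> e l" if "1 \<le> l" "l \<le> i" for l
      using that(2,1)
    proof (induction l rule: inc_induct)
      case (step l)
      then show ?case using assms(7) i by force
    qed simp
    \<comment> \<open>The first \<open>i\<close> exponents of \<open>m\<close> are
      \<open>1 + e l\<close> with \<open>e l \<ge> e i\<close>, which supplies the required
      \<open>i\<close> large exponents.\<close>
    have "{1..i} \<subseteq> {l \<in> {1..n}. e i < Poly_Mapping.lookup M l}"
      using e_mono i assms by (auto simp: lookup_M w_def less_Suc_eq_le)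
    from card_mono[OF _ this] have "P M"
      by (simp add: P_def)
    moreover have "Poly_Mapping.keys M \<subseteq> {1..n}"
      using assms by (auto simp: in_keys_iff lookup_M split: if_splits)
    ultimately have mI: "m \<in> I"
      by (simp add: I_def monomial_span_def carrier_mpoly_ring m)
    have "(p - 1) * (k - i + 1) \<le> (n - i + 1) * e i"
      unfolding pi by (rule div_times_less_eq_dividend)
    then obtain c where c: "Poly_Mapping.single c (1::'a) \<in> ideal_power n (sqfree_ideal n k) (p - 1)"
      and flat: "\<And>l. i \<le> l \<Longrightarrow> l \<le> n \<Longrightarrow> Poly_Mapping.lookup c l \<le> e i"
      using exists_flat_monomial_in_power[of i k n "p - 1" "e i", where 'a='a] i assms by auto
    \<comment> \<open>At most \<open>i - 1\<close> exponents of \<open>c\<close> exceed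
      \<open>e i\<close>, one too few for \<open>P\<close>.\<close>
    have "{l \<in> {1..n}. e i < Poly_Mapping.lookup c l} \<subseteq> {1..<i}"
    proof clarify
      fix l assume "l \<in> {1..n}" "e i < Poly_Mapping.lookup c l"
      then show "l \<in> {1..<i}" using flat[of l] by (cases "i \<le> l") auto
    qed
    from card_mono[OF _ this] have "\<not> P c"
      using i by (simp add: P_def)
    then have "Poly_Mapping.single c (1::'a) \<notin> I"
      by (simp add: I_def monomial_span_def)
    with c ideal inv mI show ?thesis
      by blast
  qed
  ultimately show ?thesis
    unfolding J by blast
qed

end
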